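(* Let $T=T_n\langle i_1,i_2;j_1\rangle$ (with $i_1<i_2$) be a Toeplitz matrix in $\mathcal{T}_{\le 2}$, let $d=\gcd(i_1+j_1,\,i_2-i_1)$, and let $r$ be the integer such that $1\le r\le d$ and $n\equiv r\pmod d$. Then the row graph of $T$ contains a cycle if and only if $i_2\ne 2i_1+j_1$, $i_2+j_1\le d\lceil n/d\rceil$, and $1+i_1\le r$. Moreover, if the row graph of $T$ contains a cycle, then the length of that cycle is $\lceil n/d\rceil$.
   Context: Write $[m]=\{1,\dots,m\}$. For disjoint subsets $\alpha=\{i_1<\cdots<i_{k_1}\}$ and $\beta=\{j_1<\cdots<j_{k_2}\}$ of $[n-1]$, not both empty, $T_n\langle\alpha;\beta\rangle=T_n\langle i_1,\ldots,i_{k_1};j_1,\ldots,j_{k_2}\rangle$ denotes the $n\times n$ $(0,1)$-matrix $(t_{u,v})$ with $t_{u,v}=1$ if and only if $u-v\in\alpha$ or $v-u\in\beta$. $\mathcal{T}_{\le 2}$ is the set of such matrices with maximum row sum (computed in the integers) at most $2$. The row graph $\mathrm{RG}(T)$ of an $n\times n$ $(0,1)$-matrix $T=(t_{u,v})$ is the simple graph with vertex set $[n]$ in which two distinct vertices $u,v$ are adjacent if and only if $t_{u,k}=t_{v,k}=1$ for some $k\in[n]$. *)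

theory Defs
  imports
    "Jordan_Normal_Form.Matrix"
    "Graph_Theory.Pair_Digraph"
    "HOL-Number_Theory.Cong"
begin

text \<open>
  Matrices index rows and columns from 0, the mathematics from 1. The Toeplitz condition depends
  only on the difference of the indices, so it is unaffected by the shift.
\<close>

definition toeplitz :: "nat \<Rightarrow> nat set \<Rightarrow> nat set \<Rightarrow> int mat" where
  "toeplitz n \<alpha> \<beta> =
     mat n n (\<lambda>(u, v). if int u - int v \<in> int ` \<alpha> \<or> int v - int u \<in> int ` \<beta> then 1 else 0)"

definition max_row_sum :: "int mat \<Rightarrow> int" where
  "max_row_sum A = Max ((\<lambda>u. \<Sum>v<dim_col A. A $$ (u, v)) ` {..<dim_row A})"

definition toeplitz_le2 :: "int mat set" where
  "toeplitz_le2 = {toeplitz n \<alpha> \<beta> | n \<alpha> \<beta>.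
     \<alpha> \<subseteq> {1..n - 1} \<and> \<beta> \<subseteq> {1..n - 1} \<and> \<alpha> \<inter> \<beta> = {} \<and> \<alpha> \<union> \<beta> \<noteq> {} \<and>
     max_row_sum (toeplitz n \<alpha> \<beta>) \<le> 2}"

text \<open>
  Simple graphs are the finite symmetric loop-free digraphs (\<open>pair_graph\<close>). The vertices of the
  row graph are the 1-based row numbers.
\<close>

definition row_graph :: "int mat \<Rightarrow> nat pair_pre_digraph" where
  "row_graph A = \<lparr> pverts = {1..dim_row A},
     parcs = {(u, v). u \<in> {1..dim_row A} \<and> v \<in> {1..dim_row A} \<and> u \<noteq> v \<and>
       (\<exists>k\<in>{1..dim_col A}. A $$ (u - 1, k - 1) = 1 \<and> A $$ (v - 1, k - 1) = 1)} \<rparr>"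

lemma pair_graph_row_graph: "pair_graph (row_graph A)"
proof -
  have "parcs (row_graph A) \<subseteq> {1..dim_row A} \<times> {1..dim_row A}"
    by (auto simp: row_graph_def)
  then have "finite (parcs (row_graph A))"
    by (rule finite_subset) auto
  then show ?thesis
    by unfold_locales (auto simp: row_graph_def symmetric_def sym_def arcs_ends_conv)
qed

text \<open>
  In a symmetric digraph \<open>pre_digraph.cycle\<close> also admits \<open>u, v, u\<close>, which traverses one edge back
  and forth; requiring at least three arcs leaves exactly the cycles of the undirected graph.
  The length of a cycle is the length of its arc list.
\<close>

definition graph_cycle :: "'a pair_pre_digraph \<Rightarrow> ('a \<times> 'a) awalk \<Rightarrow> bool" where
  "graph_cycle G p \<longleftrightarrow> pre_digraph.cycle (with_proj G) p \<and> 3 \<le> length p"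

end

theory Submission
  imports Defs
begin

text \<open>
  Put \<open>a = i1 + j1\<close> and \<open>b = i2 - i1\<close>, so \<open>a + b = i2 + j1\<close> and \<open>d = gcd a b\<close>. The bound on the
  row sums says exactly that no row meets all three diagonals, that is, \<open>n \<le> a + b\<close>. By the
  same inequality no column meets both the upper diagonal and the outer lower one. Hence two rows
  are adjacent only if they share a column on the diagonals \<open>i1, j1\<close>, and then they differ by
  \<open>a\<close>, or on the diagonals \<open>i1, i2\<close>, and then they differ by \<open>b\<close> and the smaller one exceeds
  \<open>i1\<close>. So the row graph is the undirected graph of the partial map
  \<open>x \<mapsto> x + a\<close> (if \<open>x + a \<le> n\<close>), \<open>x \<mapsto> x - b\<close> (if \<open>x - b > i1\<close>),
  which, because \<open>n \<le> a + b\<close>, is an injective restriction of the rotation by \<open>a\<close> on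
  \<open>{1..a + b}\<close>, read modulo \<open>a + b\<close>.

  On a graph cycle every vertex has two different neighbours. By injectivity they cannot both be
  predecessors, so the vertex set of the cycle is closed under the map. A set closed under the
  rotation contains a full residue class modulo \<open>d\<close>, and neighbours are congruent modulo \<open>d\<close>;
  hence the cycle is exactly one class and its length is \<open>(a + b) / d\<close>
  (\<open>rotation_closed_conditions\<close>). Let \<open>s \<in> {1..d}\<close> represent the class. Its largest element
  \<open>s + (a + b) - d\<close> must be a row, and its element \<open>s + b\<close> can only be mapped to \<open>s\<close>, which
  forces \<open>i1 < s\<close>. As \<open>n \<equiv> r\<close> modulo \<open>d\<close>, the first requirement says that
  \<open>\<lceil>n / d\<rceil> = (a + b) / d\<close> and \<open>s \<le> r\<close>. Together they give \<open>i1 < r\<close>. Finally \<open>a = b\<close> would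
  leave only two vertices in the class.

  Conversely, under the three conditions the map is defined on the whole class of \<open>r\<close>, and its
  orbit is a closed walk through \<open>(a + b) / d\<close> different rows
  (\<open>conditions_imp_closed_sequence\<close>); this number is at least \<open>3\<close> when \<open>a \<noteq> b\<close>.
\<close>

section \<open>Cycles as closed vertex sequences\<close>

lemma cas_imp_vertex_sequence:
  assumes "pre_digraph.cas (with_proj G) u p v"
  shows "\<exists>w. w 0 = u \<and> w (length p) = v \<and> p = map (\<lambda>i. (w i, w (Suc i))) [0..<length p]"
  using assms
proof (induction p arbitrary: u)
  case Nil
  then show ?case by (auto simp: pre_digraph.cas.simps)
next
  case (Cons e p)
  from Cons.prems have e: "fst e = u" and "pre_digraph.cas (with_proj G) (snd e) p v"
    by (auto simp: pre_digraph.cas.simps)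
  from Cons.IH[OF this(2)] obtain w where w: "w 0 = snd e" "w (length p) = v"
    "p = map (\<lambda>i. (w i, w (Suc i))) [0..<length p]" by blast
  let ?w = "case_nat u w"
  have "map (\<lambda>i. (?w i, ?w (Suc i))) [0..<length (e # p)]
      = (u, w 0) # map (\<lambda>i. (w i, w (Suc i))) [0..<length p]"
    unfolding length_Cons by (simp only: upt_conv_Cons map_Suc_upt[symmetric] zero_less_Suc) simp
  also have "\<dots> = e # p" using w(1,3) e by (cases e) simp
  finally have "e # p = map (\<lambda>i. (?w i, ?w (Suc i))) [0..<length (e # p)]" ..
  moreover have "?w 0 = u" "?w (length (e # p)) = v" using w by auto
  ultimately show ?case by (intro exI[of _ ?w] conjI)
qed

lemma cas_vertex_sequence:
  "pre_digraph.cas (with_proj G) (w 0) (map (\<lambda>i. (w i, w (Suc i))) [0..<L]) (w L)"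
proof (induction L arbitrary: w)
  case (Suc L)
  show ?case using Suc[of "\<lambda>i. w (Suc i)"]
    by (simp only: upt_conv_Cons map_Suc_upt[symmetric] zero_less_Suc)
      (simp add: pre_digraph.cas.simps comp_def)
qed (simp add: pre_digraph.cas.simps)

lemma awalk_verts_vertex_sequence:
  "pre_digraph.awalk_verts (with_proj G) (w 0) (map (\<lambda>i. (w i, w (Suc i))) [0..<L])
     = map w [0..<Suc L]"
proof (induction L arbitrary: w)
  case (Suc L)
  have "map w [0..<Suc (Suc L)] = w 0 # map (\<lambda>i. w (Suc i)) [0..<Suc L]"
    by (simp only: upt_conv_Cons[of 0 "Suc (Suc L)"] map_Suc_upt[symmetric] zero_less_Suc)
      (simp add: comp_def)
  then show ?case using Suc[of "\<lambda>i. w (Suc i)"]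
    by (simp only: upt_conv_Cons[of 0 "Suc L"] map_Suc_upt[symmetric] zero_less_Suc)
      (simp add: pre_digraph.awalk_verts.simps comp_def)
qed (simp add: pre_digraph.awalk_verts.simps)

text \<open>
  A walk is a list of arcs, while the rotation argument speaks of vertices. Injectivity is required
  on \<open>{1..L}\<close>, leaving out the start \<open>w 0 = w L\<close>, because \<open>pre_digraph.cycle\<close> asks for
  distinctness of the tail of the vertex list.
\<close>

lemma graph_cycle_iff_closed_sequence:
  assumes "pair_graph G"
  shows "(\<exists>p. graph_cycle G p \<and> length p = L) \<longleftrightarrow>
    3 \<le> L \<and> (\<exists>w. (\<forall>i<L. (w i, w (Suc i)) \<in> parcs G) \<and> w 0 = w L \<and> inj_on w {1..L})"
    (is "?l \<longleftrightarrow> ?r")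
proof -
  have tl: "tl (map w [0..<Suc L]) = map w [1..<Suc L]" for w :: "nat \<Rightarrow> 'a"
    by (simp only: upt_conv_Cons[of 0 "Suc L"] zero_less_Suc) simp
  show ?thesis
  proof
    assume ?l
    then obtain p u where p: "3 \<le> length p" "length p = L"
      and aw: "pre_digraph.awalk (with_proj G) u p u"
      and dist: "distinct (tl (pre_digraph.awalk_verts (with_proj G) u p))"
      unfolding graph_cycle_def pre_digraph.cycle_def by blast
    from aw have "pre_digraph.cas (with_proj G) u p u" and sub: "set p \<subseteq> parcs G"
      by (auto simp: pre_digraph.awalk_def)
    from cas_imp_vertex_sequence[OF this(1)] p obtain w where w: "w 0 = u" "w L = u"
      and pe: "p = map (\<lambda>i. (w i, w (Suc i))) [0..<L]" by blast
    have "distinct (map w [1..<Suc L])"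
      using dist awalk_verts_vertex_sequence[of G w L] w pe tl by metis
    then have "inj_on w {1..L}"
      by (simp add: distinct_map atLeastLessThanSuc_atLeastAtMost del: upt_Suc)
    moreover have "\<forall>i<L. (w i, w (Suc i)) \<in> parcs G" using sub pe by auto
    ultimately show ?r using w p by auto
  next
    assume ?r
    then obtain w where L: "3 \<le> L" and arcs: "\<forall>i<L. (w i, w (Suc i)) \<in> parcs G"
      and w: "w 0 = w L" "inj_on w {1..L}" by blast
    interpret pair_graph G by fact
    let ?p = "map (\<lambda>i. (w i, w (Suc i))) [0..<L]"
    have "(w 0, w (Suc 0)) \<in> parcs G" using arcs L by auto
    then have "w 0 \<in> pverts G" using in_arcsD1 by auto
    then have "pre_digraph.awalk (with_proj G) (w 0) ?p (w 0)"
      using cas_vertex_sequence[of G w L] arcs w by (auto simp: pre_digraph.awalk_def)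
    moreover have "distinct (tl (pre_digraph.awalk_verts (with_proj G) (w 0) ?p))"
      using w(2) unfolding awalk_verts_vertex_sequence tl
      by (simp add: distinct_map atLeastLessThanSuc_atLeastAtMost del: upt_Suc)
    moreover have "?p \<noteq> []" using L by simp
    ultimately have "graph_cycle G ?p"
      using L unfolding graph_cycle_def pre_digraph.cycle_def by auto
    moreover have "length ?p = L" by simp
    ultimately show ?l by blast
  qed
qed

text \<open>
  The neighbours are the cyclic predecessor and successor. They are different because the cycle has
  at least three vertices.
\<close>

lemma closed_sequence_neighbours:
  assumes "sym A" and L: "3 \<le> L" and arcs: "\<And>i. i < L \<Longrightarrow> (w i, w (Suc i)) \<in> A"
    and closed: "w 0 = w L" and inj: "inj_on w {1..L}" and x: "x \<in> w ` {1..L}"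
  shows "\<exists>y\<in>w ` {1..L}. \<exists>z\<in>w ` {1..L}. y \<noteq> z \<and> (x, y) \<in> A \<and> (x, z) \<in> A"
proof -
  obtain i where i: "i \<in> {1..L}" "x = w i" using x by blast
  \<comment> \<open>Indices stay in \<open>{1..L}\<close>, where \<open>w\<close> is injective, so \<open>w 0\<close> is addressed as \<open>w L\<close>.\<close>
  define j where "j = (if i = 1 then L else i - 1)"
  define k where "k = (if i = L then 1 else Suc i)"
  have jk: "j \<in> {1..L}" "k \<in> {1..L}" "j \<noteq> k" using i L by (auto simp: j_def k_def)
  have "(w j, x) \<in> A"
    using arcs[of "i - 1"] i closed by (auto simp: j_def split: if_splits)
  then have "(x, w j) \<in> A" using \<open>sym A\<close> by (auto dest: symD)
  moreover have "(x, w k) \<in> A"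
    using arcs[of i] arcs[of 0] i L closed by (auto simp: k_def)
  moreover have "w j \<noteq> w k" using inj jk by (auto dest: inj_onD)
  ultimately show ?thesis using jk by blast
qed

section \<open>Representatives of residue classes in \<open>{1..m}\<close>\<close>

lemma cong_imp_eq_of_positive_le:
  fixes x y m :: nat
  assumes "[x = y] (mod m)" "x \<in> {1..m}" "y \<in> {1..m}"
  shows "x = y"
proof -
  have "[(x - 1) + 1 = (y - 1) + 1] (mod m)" using assms by simp
  then have "[x - 1 = y - 1] (mod m)" by (simp only: cong_add_rcancel_nat)
  then have "x - 1 = y - 1" using assms by (intro cong_less_modulus_unique_nat) auto
  then show ?thesis using assms by auto
qed

lemma cong_less_imp_add_modulus_le:
  fixes x y d :: nat
  assumes "[x = y] (mod d)" "x < y"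
  shows "x + d \<le> y"
proof -
  have "d dvd y - x" using assms by (metis cong_altdef_nat cong_sym less_imp_le)
  then have "d \<le> y - x" using assms(2) by (intro dvd_imp_le) auto
  then show ?thesis using assms(2) by linarith
qed

lemma card_residue_class:
  fixes d M s :: nat
  assumes "s \<in> {1..d}"
  shows "card {t \<in> {1..d * M}. [t = s] (mod d)} = M"
proof -
  have "{t \<in> {1..d * M}. [t = s] (mod d)} = (\<lambda>j. s + d * j) ` {..<M}" (is "?C = ?I")
  proof (intro equalityI subsetI)
    fix t assume t: "t \<in> ?C"
    define j where "j = (t - 1) div d"
    have d: "0 < d" using assms by auto
    have "t - 1 = d * j + (t - 1) mod d" unfolding j_def by (rule mult_div_mod_eq[symmetric])
    moreover have "1 \<le> t" using t by simp
    ultimately have "t = (t - 1) mod d + 1 + d * j" by linarith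
    moreover have "(t - 1) mod d + 1 = s"
    proof (rule cong_imp_eq_of_positive_le)
      have "[(t - 1) mod d + 1 = (t - 1) + 1] (mod d)" by (intro cong_add) simp_all
      also have "(t - 1) + 1 = t" using t by simp
      also have "[t = s] (mod d)" using t by simp
      finally show "[(t - 1) mod d + 1 = s] (mod d)" .
      show "(t - 1) mod d + 1 \<in> {1..d}" using d by (simp add: Suc_le_eq)
    qed (use assms in auto)
    moreover have "j < M" unfolding j_def
      using t d by (intro less_mult_imp_div_less) (auto simp: mult.commute)
    ultimately show "t \<in> ?I" by auto
  next
    fix t assume "t \<in> ?I"
    then obtain j where j: "j < M" "t = s + d * j" by auto
    have "d * Suc j \<le> d * M" using j by (intro mult_le_mono2) simp
    then show "t \<in> ?C" using j assms by (simp add: cong_def)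
  qed
  moreover have "inj_on (\<lambda>j. s + d * j) {..<M}" using assms by (auto simp: inj_on_def)
  ultimately show ?thesis by (simp add: card_image)
qed

section \<open>Partial rotations\<close>

text \<open>
  For \<open>n \<le> a + b\<close> this relation is a restriction of the rotation by \<open>a\<close> modulo \<open>a + b\<close> on
  \<open>{1..a + b}\<close>: the second disjunct, a step down by \<open>b\<close>, is the step up by \<open>a\<close> wrapped around.
  The parameter \<open>c\<close> limits the landing points of the wrapped steps.
\<close>

definition partial_rotation :: "nat \<Rightarrow> nat \<Rightarrow> nat \<Rightarrow> nat \<Rightarrow> (nat \<times> nat) set" where
  "partial_rotation n c a b =
     {(u, v). v = u + a \<and> 1 \<le> u \<and> v \<le> n \<or> u = v + b \<and> c < v \<and> u \<le> n}"

text \<open>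
  A step up by \<open>a\<close> lands above \<open>a\<close>, whereas a step down by \<open>b\<close> lands at or below \<open>n - b \<le> a\<close>.
\<close>

lemma partial_rotation_injective:
  assumes "n \<le> a + b" "(x, z) \<in> partial_rotation n c a b" "(y, z) \<in> partial_rotation n c a b"
  shows "x = y"
  using assms by (auto simp: partial_rotation_def)

lemma partial_rotation_cong:
  assumes "(x, y) \<in> partial_rotation n c a b"
  shows "[y = x + a] (mod (a + b))"
proof -
  consider "y = x + a" | "x = y + b" using assms by (auto simp: partial_rotation_def)
  then show ?thesis
  proof cases
    case 2
    then have "x + a = y + (a + b)" by simp
    then show ?thesis by (simp only: cong_def mod_add_self2)
  qed simp
qed

section \<open>Cycles of a partial rotation\<close>

text \<open>
  Iterating steps from \<open>s\<close> reaches every residue \<open>s + k * a\<close> modulo \<open>a + b\<close>. By Bezout these are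
  all residues congruent to \<open>s\<close> modulo \<open>gcd a (a + b) = gcd a b\<close>, and a residue has only one
  representative in \<open>{1..a + b}\<close>.
\<close>

lemma rotation_closed_contains_class:
  fixes a b :: nat
  assumes closed: "\<And>x. x \<in> S \<Longrightarrow> \<exists>y\<in>S. (x, y) \<in> partial_rotation n c a b"
    and S: "S \<subseteq> {1..a + b}" and s: "s \<in> S" and "0 < a"
    and t: "t \<in> {1..a + b}" "[t = s] (mod gcd a b)"
  shows "t \<in> S"
proof -
  let ?m = "a + b"
  have orbit: "\<exists>z\<in>S. [z = s + k * a] (mod ?m)" for k
  proof (induction k)
    case 0
    show ?case using s by (intro bexI[of _ s]) simp_all
  next
    case (Suc k)
    then obtain z where z: "z \<in> S" "[z = s + k * a] (mod ?m)" by blast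
    obtain y where y: "y \<in> S" "(z, y) \<in> partial_rotation n c a b" using closed z by blast
    have "[y = z + a] (mod ?m)" using partial_rotation_cong y by blast
    also have "[z + a = s + k * a + a] (mod ?m)" using z by (intro cong_add) auto
    also have "s + k * a + a = s + Suc k * a" by simp
    finally show ?case using y by blast
  qed
  have "s \<le> ?m" using s S by auto
  have g: "gcd a ?m = gcd a b" by simp
  obtain x where x: "[a * x = gcd a b] (mod ?m)"
    using cong_solve_nat[of a ?m] \<open>0 < a\<close> unfolding g by auto
  \<comment> \<open>The term \<open>?m - s\<close> stands for \<open>-s\<close> modulo \<open>?m\<close>, which avoids truncated subtraction.\<close>
  have "gcd a b dvd t + (?m - s)"
  proof -
    have "[t + (?m - s) = s + (?m - s)] (mod gcd a b)" using t by (intro cong_add) auto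
    also have "s + (?m - s) = ?m" using \<open>s \<le> ?m\<close> by simp
    finally have "[t + (?m - s) = ?m] (mod gcd a b)" .
    moreover have "gcd a b dvd ?m" by simp
    ultimately show ?thesis using cong_dvd_iff by blast
  qed
  then obtain q where q: "t + (?m - s) = gcd a b * q" ..
  obtain z where z: "z \<in> S" "[z = s + (x * q) * a] (mod ?m)" using orbit by blast
  note z(2)
  also have "s + (x * q) * a = s + (a * x) * q" by simp
  also have "[s + (a * x) * q = s + gcd a b * q] (mod ?m)"
    using x by (intro cong_add cong_mult) auto
  also have "s + gcd a b * q = t + ?m" using q \<open>s \<le> ?m\<close> by linarith
  also have "[t + ?m = t] (mod ?m)" by (simp only: cong_def mod_add_self2)
  finally have "[z = t] (mod ?m)" .
  then have "z = t" using cong_imp_eq_of_positive_le z S t by blast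
  then show ?thesis using z by simp
qed

text \<open>
  A closed set within one residue class modulo \<open>d\<close> is that whole class. The inequalities come from
  two of its elements: the largest one has to be at most \<open>n\<close>, and \<open>s + b\<close> cannot step up, since
  \<open>s + b + a > n\<close>, so it steps down to \<open>s\<close>, which is a legal landing point only above \<open>c\<close>.
\<close>

lemma rotation_closed_conditions:
  fixes a b c d n :: nat
  assumes closed: "\<And>x. x \<in> S \<Longrightarrow> \<exists>y\<in>S. (x, y) \<in> partial_rotation n c a b"
    and ne: "S \<noteq> {}" and n: "n \<le> a + b" and "0 < a" and d_def: "d = gcd a b"
    and congS: "\<And>x y. x \<in> S \<Longrightarrow> y \<in> S \<Longrightarrow> [x = y] (mod d)"
  obtains s where "s \<in> {1..d}" "c < s" "s + (a + b) \<le> n + d" "card S * d = a + b"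
proof -
  have Sn: "x \<in> {1..n}" if "x \<in> S" for x
    using closed[OF that] by (auto simp: partial_rotation_def)
  then have Sm: "S \<subseteq> {1..a + b}" using n by force
  obtain x where x: "x \<in> S" using ne by blast
  define s where "s = (x - 1) mod d + 1"
  have d: "0 < d" "d \<le> a" using \<open>0 < a\<close> by (auto simp: d_def gcd_le1_nat)
  have db: "d dvd b" "d dvd a + b" by (simp_all add: d_def)
  have "(x - 1) mod d < d" using d by simp
  then have s: "1 \<le> s" "s \<le> d" unfolding s_def by linarith+
  have "[s = (x - 1) + 1] (mod d)" unfolding s_def by (intro cong_add) simp_all
  moreover have "(x - 1) + 1 = x" using Sn[OF x] by simp
  ultimately have sx: "[s = x] (mod d)" by simp
  have S: "t \<in> S" if "t \<in> {1..a + b}" "[t = s] (mod d)" for t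
    using rotation_closed_contains_class[OF closed Sm x \<open>0 < a\<close> that(1)] that(2) sx cong_trans
    unfolding d_def by blast
  obtain M where M: "a + b = d * M" using db(2) ..
  have "S = {t \<in> {1..d * M}. [t = s] (mod d)}"
  proof (intro equalityI subsetI)
    fix t assume "t \<in> S"
    moreover from this have "[t = s] (mod d)" using congS[OF _ x] cong_trans cong_sym[OF sx] by blast
    ultimately show "t \<in> {t \<in> {1..d * M}. [t = s] (mod d)}" using Sm M by auto
  next
    fix t assume "t \<in> {t \<in> {1..d * M}. [t = s] (mod d)}"
    then show "t \<in> S" using S M by simp
  qed
  then have card: "card S * d = a + b" using card_residue_class[of s d M] s M by simp
  have "s + (a + b - d) \<in> S"
  proof (rule S)
    have "d dvd a + b - d" using db by simp
    then have "[s + (a + b - d) = s + 0] (mod d)" by (intro cong_add) (simp_all add: cong_0_iff)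
    then show "[s + (a + b - d) = s] (mod d)" by simp
    show "s + (a + b - d) \<in> {1..a + b}" using s d unfolding atLeastAtMost_iff by linarith
  qed
  then have "s + (a + b - d) \<le> n" using Sn by simp
  then have upper: "s + (a + b) \<le> n + d" using d by linarith
  have "s + b \<in> S"
  proof (rule S)
    have "[s + b = s + 0] (mod d)" using db(1) by (intro cong_add) (simp_all add: cong_0_iff)
    then show "[s + b = s] (mod d)" by simp
    show "s + b \<in> {1..a + b}" using s d by simp
  qed
  then obtain y where "(s + b, y) \<in> partial_rotation n c a b" using closed by blast
  then have "c < s" using n s unfolding partial_rotation_def by auto
  then show ?thesis using that[of s] s upper card by simp
qed

text \<open>
  The direction in which the cycle runs need not be determined: each vertex has two different
  neighbours, at most one of which is a predecessor, so the other one is its successor. This makes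
  the vertex set closed.
\<close>

lemma closed_sequence_imp_conditions:
  fixes a b c d n :: nat
  defines "R \<equiv> partial_rotation n c a b"
  assumes n: "n \<le> a + b" and "0 < a" and L: "3 \<le> L" and d: "d = gcd a b"
    and arcs: "\<And>i. i < L \<Longrightarrow> (w i, w (Suc i)) \<in> R \<union> R\<inverse>"
    and w: "w 0 = w L" "inj_on w {1..L}"
  obtains s where "s \<in> {1..d}" "c < s" "s + (a + b) \<le> n + d" "L * d = a + b"
proof -
  let ?S = "w ` {1..L}"
  have "sym (R \<union> R\<inverse>)" by (auto simp: sym_def)
  note nbs = closed_sequence_neighbours[OF this L arcs w]
  have closed: "\<exists>y\<in>?S. (x, y) \<in> partial_rotation n c a b" if x: "x \<in> ?S" for x
  proof -
    obtain y z where yz: "y \<in> ?S" "z \<in> ?S" "y \<noteq> z" "(x, y) \<in> R \<union> R\<inverse>" "(x, z) \<in> R \<union> R\<inverse>"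
      using nbs x by blast
    then have "(x, y) \<in> R \<or> (x, z) \<in> R"
      using partial_rotation_injective[OF n, of y x c z] unfolding R_def by blast
    then show ?thesis using yz unfolding R_def by blast
  qed
  have db: "d dvd a" "d dvd b" by (simp_all add: d)
  have R_cong: "[x = y] (mod d)" if xy: "(x, y) \<in> R \<union> R\<inverse>" for x y
  proof -
    have "[u + e = u] (mod d)" if "d dvd e" for u e
      using cong_add[of u u d e 0] that by (simp add: cong_0_iff)
    with db have e: "[u + a = u] (mod d)" "[u + b = u] (mod d)"
      "[u = u + a] (mod d)" "[u = u + b] (mod d)" for u
      using cong_sym by blast+
    consider "y = x + a" | "x = y + b" | "x = y + a" | "y = x + b"
      using xy unfolding R_def partial_rotation_def by blast
    then show ?thesis by cases (simp_all only: e)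
  qed
  have w0: "[w i = w 0] (mod d)" if "i \<le> L" for i
    using that
  proof (induction i)
    case (Suc i)
    have "[w i = w (Suc i)] (mod d)" using Suc.prems by (intro R_cong arcs) simp
    moreover have "[w i = w 0] (mod d)" using Suc by simp
    ultimately show ?case using cong_trans cong_sym by blast
  qed simp
  have same: "[x = y] (mod d)" if "x \<in> ?S" "y \<in> ?S" for x y
  proof -
    have "[x = w 0] (mod d)" "[y = w 0] (mod d)" using that w0 by auto
    then show ?thesis using cong_trans cong_sym by blast
  qed
  have "?S \<noteq> {}" using L by auto
  from rotation_closed_conditions[OF closed this n \<open>0 < a\<close> d same]
  obtain s where "s \<in> {1..d}" "c < s" "s + (a + b) \<le> n + d" "card ?S * d = a + b" by blast
  then show ?thesis using that[of s] w(2) by (simp add: card_image)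
qed

text \<open>
  The orbit of \<open>r\<close> under the rotation never meets a point where the partial rotation is undefined.
  All its elements are congruent to \<open>n\<close> modulo \<open>d\<close>. So an element above \<open>n\<close> would be at least
  \<open>n + d\<close>, which exceeds \<open>a + b\<close>. An element \<open>x\<close> with \<open>x + a > n\<close> satisfies
  \<open>x + a \<ge> n + d = a + b + r\<close>, so \<open>x - b \<ge> r > c\<close> and the step down is legal.
\<close>

lemma conditions_imp_closed_sequence:
  fixes a b d r L n c :: nat
  assumes r: "c < r" "r \<le> d" and d: "d = gcd a b" and pos: "0 < a"
    and n: "n + d = a + b + r" and L: "L * d = a + b"
  shows "\<exists>w. (\<forall>i<L. (w i, w (Suc i)) \<in> partial_rotation n c a b) \<and> w 0 = w L \<and> inj_on w {1..L}"
proof -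
  let ?m = "a + b"
  \<comment> \<open>The shift by one puts the representatives modulo \<open>?m\<close> into \<open>{1..?m}\<close> instead of \<open>{0..<?m}\<close>.\<close>
  define w where "w k = (r - 1 + k * a) mod ?m + 1" for k
  have "0 < d" using d pos by simp
  have m: "0 < ?m" using pos by simp
  have db: "d dvd a" "d dvd ?m" by (simp_all add: d)
  have w_range: "w k \<in> {1..?m}" for k
    using m unfolding w_def by (simp add: Suc_le_eq del: add_gr_0)
  have w_cong: "[w k = r + k * a] (mod ?m)" for k
  proof -
    have "[w k = (r - 1 + k * a) + 1] (mod ?m)" unfolding w_def by (intro cong_add) simp_all
    also have "(r - 1 + k * a) + 1 = r + k * a" using r by simp
    finally show ?thesis .
  qed
  have w_class: "[w k = r] (mod d)" for k
  proof -
    have "[w k = r + k * a] (mod d)" using w_cong db(2) by (rule cong_dvd_modulus_nat)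
    also have "[r + k * a = r + 0] (mod d)"
      using db(1) by (intro cong_add) (simp_all add: cong_0_iff)
    finally show ?thesis by simp
  qed
  have n_class: "[n = r] (mod d)"
  proof -
    have "[n + d = r + 0] (mod d)"
      unfolding n using db(2) by (subst add.commute, intro cong_add) (simp_all add: cong_0_iff)
    then show ?thesis by (simp add: cong_def)
  qed
  have w_le: "w k \<le> n" for k
  proof (rule ccontr)
    assume "\<not> w k \<le> n"
    then have "n + d \<le> w k"
      using cong_less_imp_add_modulus_le w_class n_class cong_sym cong_trans not_le by metis
    then show False using w_range[of k] n r by simp
  qed
  have w_Suc: "[w (Suc k) = w k + a] (mod ?m)" for k
  proof -
    have "[w (Suc k) = (r + k * a) + a] (mod ?m)" using w_cong[of "Suc k"] by (simp add: ac_simps)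
    also have "[(r + k * a) + a = w k + a] (mod ?m)"
      using w_cong cong_sym by (intro cong_add) auto
    finally show ?thesis .
  qed
  have arc: "(w k, w (Suc k)) \<in> partial_rotation n c a b" for k
  proof (cases "w k + a \<le> n")
    case True
    have "w k + a \<in> {1..?m}" using True n r w_range[of k] by simp
    then have "w (Suc k) = w k + a"
      using cong_imp_eq_of_positive_le[OF w_Suc w_range] by blast
    then show ?thesis using True w_range[of k] by (simp add: partial_rotation_def)
  next
    case False
    have "[w k + a = r + 0] (mod d)"
      using db(1) w_class by (intro cong_add) (simp_all add: cong_0_iff)
    then have "[n = w k + a] (mod d)" using n_class cong_sym cong_trans by (metis add_0_right)
    then have "n + d \<le> w k + a" using False cong_less_imp_add_modulus_le by simp
    then have ge: "b + r \<le> w k" using n by simp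
    have "[w (Suc k) = (w k - b) + ?m] (mod ?m)"
      using w_Suc[of k] ge by (simp add: ac_simps)
    then have "[w (Suc k) = w k - b] (mod ?m)" by (simp only: cong_def mod_add_self2)
    moreover have "w k - b \<in> {1..?m}" using ge r w_range[of k] by auto
    ultimately have "w (Suc k) = w k - b"
      using cong_imp_eq_of_positive_le w_range by blast
    then show ?thesis using ge r w_le[of k] by (auto simp: partial_rotation_def)
  qed
  obtain a' where a': "a = d * a'" using db(1) ..
  have mL: "?m = d * L" using L by (simp add: mult.commute)
  have "w 0 = w L"
  proof (rule cong_imp_eq_of_positive_le[OF _ w_range w_range])
    have "L * a = ?m * a'" unfolding mL using a' by (simp add: ac_simps)
    then have "[r + L * a = r + 0] (mod ?m)" by (intro cong_add) (simp_all add: cong_0_iff)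
    then show "[w 0 = w L] (mod ?m)" using w_cong[of 0] w_cong[of L] cong_sym cong_trans
      by (metis mult_zero_left)
  qed
  moreover have "inj_on w {1..L}"
  proof (rule inj_onI)
    fix i j assume ij: "i \<in> {1..L}" "j \<in> {1..L}" "w i = w j"
    have "d * gcd a' L = gcd (d * a') (d * L)" by (rule gcd_mult_distrib_nat)
    also have "\<dots> = gcd a ?m" by (simp only: a'[symmetric] mL)
    also have "\<dots> = d" by (simp add: d)
    finally have "gcd a' L = 1" using \<open>0 < d\<close> by simp
    then have "coprime a' L" by (simp only: coprime_iff_gcd_eq_1)
    have "[r + i * a = r + j * a] (mod ?m)"
      using w_cong[of i] w_cong[of j] ij(3) cong_sym cong_trans by metis
    then have "[i * a = j * a] (mod ?m)" by (simp only: cong_add_lcancel_nat)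
    moreover have "i * a = d * (i * a')" "j * a = d * (j * a')" by (simp_all add: a')
    ultimately have "[d * (i * a') = d * (j * a')] (mod d * L)" by (simp only: mL)
    then have "[i * a' = j * a'] (mod L)"
      using \<open>0 < d\<close> unfolding cong_def mod_mult_mult1 by simp
    then have "[i = j] (mod L)" using \<open>coprime a' L\<close> cong_mult_rcancel_nat by blast
    then show "i = j" using cong_imp_eq_of_positive_le ij by blast
  qed
  ultimately show ?thesis using arc by blast
qed

section \<open>Row graphs of Toeplitz matrices with two lower diagonals and one upper diagonal\<close>

text \<open>
  Otherwise row \<open>i2\<close>, counted from \<open>0\<close>, meets all three diagonals and has row sum \<open>3\<close>.
\<close>

lemma toeplitz_le2_imp:
  assumes "{i1, i2} \<subseteq> {1..n - 1}" "{j1} \<subseteq> {1..n - 1}" "i1 < i2"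
    and "toeplitz n {i1, i2} {j1} \<in> toeplitz_le2"
  shows "n \<le> i2 + j1"
proof (rule ccontr)
  let ?T = "toeplitz n {i1, i2} {j1}"
  assume "\<not> n \<le> i2 + j1"
  then have n: "i2 + j1 < n" by simp
  have dims: "dim_row ?T = n" "dim_col ?T = n" by (auto simp: toeplitz_def)
  let ?C = "{0, i2 - i1, i2 + j1}"
  have "3 = (\<Sum>v\<in>?C. ?T $$ (i2, v))"
    using assms(1-3) n by (auto simp: toeplitz_def)
  also have "\<dots> \<le> (\<Sum>v<n. ?T $$ (i2, v))"
    using n by (intro sum_mono2) (auto simp: toeplitz_def)
  also have "\<dots> \<le> max_row_sum ?T"
    unfolding max_row_sum_def dims using n by (intro Max_ge) auto
  finally show False using assms(4) unfolding toeplitz_le2_def by auto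
qed

text \<open>
  Rows sharing column \<open>k\<close> are two of \<open>k - j1\<close>, \<open>k + i1\<close> and \<open>k + i2\<close>. The pair \<open>k - j1\<close>, \<open>k + i2\<close>
  cannot occur, as it would need \<open>k > j1\<close> and \<open>k + i2 \<le> n \<le> i2 + j1\<close>. The pair \<open>k + i1\<close>,
  \<open>k + i2\<close> starts above \<open>i1\<close>, which is the bound on the landing points.
\<close>

lemma parcs_row_graph_toeplitz:
  assumes n: "n \<le> i2 + j1" and i: "1 \<le> i1" "i1 < i2" and j: "1 \<le> j1"
  defines "R \<equiv> partial_rotation n i1 (i1 + j1) (i2 - i1)"
  shows "parcs (row_graph (toeplitz n {i1, i2} {j1})) = R \<union> R\<inverse>"
proof -
  let ?T = "toeplitz n {i1, i2} {j1}"
  have dims: "dim_row ?T = n" "dim_col ?T = n" by (auto simp: toeplitz_def)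
  have entry: "?T $$ (u - 1, k - 1) = 1 \<longleftrightarrow> u = k + i1 \<or> u = k + i2 \<or> k = u + j1"
    if "u \<in> {1..n}" "k \<in> {1..n}" for u k
    using that i j by (auto simp: toeplitz_def split: if_splits)
  have "(u, v) \<in> parcs (row_graph ?T) \<longleftrightarrow> (u, v) \<in> R \<union> R\<inverse>" for u v
  proof
    assume "(u, v) \<in> parcs (row_graph ?T)"
    then obtain k where "u \<in> {1..n}" "v \<in> {1..n}" "u \<noteq> v" "k \<in> {1..n}"
      "?T $$ (u - 1, k - 1) = 1" "?T $$ (v - 1, k - 1) = 1"
      by (auto simp: row_graph_def dims)
    then show "(u, v) \<in> R \<union> R\<inverse>"
      using entry n i j unfolding R_def partial_rotation_def by auto
  next
    have arc: "(u, v) \<in> parcs (row_graph ?T)"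
      if "u \<in> {1..n}" "v \<in> {1..n}" "u \<noteq> v" "k \<in> {1..n}"
        "u = k + i1 \<or> u = k + i2 \<or> k = u + j1" "v = k + i1 \<or> v = k + i2 \<or> k = v + j1" for u v k
      using that entry by (auto simp: row_graph_def dims)
    have R: "(u, v) \<in> parcs (row_graph ?T) \<and> (v, u) \<in> parcs (row_graph ?T)"
      if uv: "(u, v) \<in> R" for u v
    proof -
      consider "v = u + (i1 + j1)" "1 \<le> u" "v \<le> n" | "u = v + (i2 - i1)" "i1 < v" "u \<le> n"
        using uv unfolding R_def partial_rotation_def by blast
      then show ?thesis
      proof cases
        case 1
        then show ?thesis using arc[of u v "u + j1"] arc[of v u "u + j1"] i j by simp
      next
        case 2
        define k where "k = v - i1"
        with 2 have "v = k + i1" "1 \<le> k" by auto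
        moreover from this have "u = k + i2" using 2 i by simp
        ultimately show ?thesis using arc[of u v k] arc[of v u k] 2 i by simp
      qed
    qed
    assume "(u, v) \<in> R \<union> R\<inverse>"
    then show "(u, v) \<in> parcs (row_graph ?T)" using R by blast
  qed
  then show ?thesis by auto
qed

theorem theorem3p9:
  fixes n i1 i2 j1 d r :: nat and T :: "int mat"
  assumes "{i1, i2} \<subseteq> {1..n - 1}" and "{j1} \<subseteq> {1..n - 1}"
    and "{i1, i2} \<inter> {j1} = {}" and "i1 < i2"
    and "T = toeplitz n {i1, i2} {j1}" and "T \<in> toeplitz_le2"
    and "d = gcd (i1 + j1) (i2 - i1)"
    and "1 \<le> r" and "r \<le> d" and "[n = r] (mod d)"
  shows "((\<exists>p. graph_cycle (row_graph T) p) \<longleftrightarrow>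
            i2 \<noteq> 2 * i1 + j1 \<and>
            int (i2 + j1) \<le> int d * \<lceil>real n / real d\<rceil> \<and>
            1 + i1 \<le> r) \<and>
         (\<forall>p. graph_cycle (row_graph T) p \<longrightarrow> int (length p) = \<lceil>real n / real d\<rceil>)"
proof -
  define a where "a = i1 + j1"
  define b where "b = i2 - i1"
  let ?R = "partial_rotation n i1 a b"
  have pos: "1 \<le> i1" "1 \<le> j1" "1 \<le> n" "0 < a" "0 < b" "0 < d"
    using assms(1,2,4,8,9) by (auto simp: a_def b_def)
  have ab: "a + b = i2 + j1" "a = b \<longleftrightarrow> i2 = 2 * i1 + j1"
    using assms(4) by (auto simp: a_def b_def)
  have d: "d = gcd a b" using assms(7) by (simp add: a_def b_def)
  have "n \<le> i2 + j1" using toeplitz_le2_imp assms(1,2,4,5,6) by blast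
  then have n: "n \<le> a + b" using ab by simp
  have arcs: "parcs (row_graph T) = ?R \<union> ?R\<inverse>"
    using parcs_row_graph_toeplitz[OF \<open>n \<le> i2 + j1\<close> pos(1) assms(4) pos(2)]
    unfolding assms(5) a_def b_def .
  obtain M where M: "a + b = d * M"
    using d by (metis dvd_add dvd_def gcd_dvd1 gcd_dvd2)

  have "r \<le> n"
  proof (rule ccontr)
    assume "\<not> r \<le> n"
    then have "n + d \<le> r" using assms(10) cong_less_imp_add_modulus_le by simp
    then show False using pos assms(9) by simp
  qed
  then have "d dvd n - r" using assms(10) by (simp add: cong_altdef_nat)
  then obtain q where "n - r = d * q" ..
  then have nq: "n = d * q + r" using \<open>r \<le> n\<close> by simp
  have ceil: "\<lceil>real n / real d\<rceil> = int q + 1"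
  proof (rule ceiling_unique)
    show "real_of_int (int q + 1) - 1 < real n / real d"
      using pos assms(8) by (simp add: nq field_simps)
    show "real n / real d \<le> real_of_int (int q + 1)"
      using pos assms(9) by (simp add: nq field_simps)
  qed
  \<comment> \<open>From \<open>q < M\<close> the bound \<open>d * \<lceil>n / d\<rceil> \<le> a + b\<close> always holds, so the second condition is an equality.\<close>
  have "d * q < d * M" using n nq M assms(8) by linarith
  then have "q < M" by simp
  have bound: "int (i2 + j1) \<le> int d * \<lceil>real n / real d\<rceil> \<longleftrightarrow> M = Suc q"
  proof -
    have "int (i2 + j1) \<le> int d * \<lceil>real n / real d\<rceil> \<longleftrightarrow> int (d * M) \<le> int (d * Suc q)"
      unfolding ceil ab(1)[symmetric] M by (simp add: distrib_left add.commute)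
    also have "\<dots> \<longleftrightarrow> M \<le> Suc q"
      using pos(6) by (simp only: of_nat_le_iff mult_le_cancel1) simp
    finally show ?thesis using \<open>q < M\<close> by auto
  qed

  have cycle: "i2 \<noteq> 2 * i1 + j1 \<and> M = Suc q \<and> 1 + i1 \<le> r \<and> length p = Suc q"
    if p: "graph_cycle (row_graph T) p" for p
  proof -
    let ?L = "length p"
    obtain w where L: "3 \<le> ?L" and w: "\<forall>i<?L. (w i, w (Suc i)) \<in> ?R \<union> ?R\<inverse>"
      "w 0 = w ?L" "inj_on w {1..?L}"
      using p graph_cycle_iff_closed_sequence[OF pair_graph_row_graph, of T ?L]
      unfolding arcs by blast
    then obtain s where s: "s \<in> {1..d}" "i1 < s" "s + (a + b) \<le> n + d" and Ld: "?L * d = a + b"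
      using closed_sequence_imp_conditions[OF n pos(4) L d] by metis
    have "?L = M" using Ld M pos by (simp add: mult.commute)
    have "a \<noteq> b"
    proof
      assume "a = b"
      then have "?L * d = 2 * d" using Ld d by simp
      then show False using L pos by simp
    qed
    have "d * M < d * Suc (Suc q)" using s nq M assms(9) by simp
    then have "M < Suc (Suc q)" by (simp only: mult_less_cancel1)
    then have Mq: "M = Suc q" using \<open>q < M\<close> by simp
    then have "s \<le> r" using s(3) unfolding M nq by simp
    then show ?thesis using \<open>?L = M\<close> Mq s ab(2) \<open>a \<noteq> b\<close> by simp
  qed
  moreover have "\<exists>p. graph_cycle (row_graph T) p"
    if cond: "i2 \<noteq> 2 * i1 + j1" "M = Suc q" "1 + i1 \<le> r"
  proof -
    have "n + d = a + b + r" unfolding M nq cond(2) by simp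
    then obtain w where w: "\<forall>i<M. (w i, w (Suc i)) \<in> ?R" "w 0 = w M" "inj_on w {1..M}"
      using conditions_imp_closed_sequence[of i1 r d a b n M] cond assms(9) d pos M
      by (auto simp: mult.commute)
    have "3 \<le> M"
    proof (rule ccontr)
      assume "\<not> 3 \<le> M"
      then have "d * M \<le> d * 2" by simp
      moreover have "d \<le> a" "d \<le> b" using d pos by (simp_all add: gcd_le1_nat gcd_le2_nat)
      ultimately have "a = b" using M by linarith
      then show False using cond ab by simp
    qed
    then show ?thesis
      using w graph_cycle_iff_closed_sequence[OF pair_graph_row_graph, of T M]
      unfolding arcs by blast
  qed
  ultimately show ?thesis unfolding bound unfolding ceil by auto
qed

end
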